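(* For every integer $n\ge 0$, the Coxeter system $\mathbf{A_n}$ is cube-like with respect to a set $J$ such that $\iota_0(G(\mathbf{A_n}^J))\ge \lceil \tfrac{n}{2}\rceil !$.
   Context: $\mathbf{A_n}$ is the Coxeter system $(S_{n+1},\{(1\,2),(2\,3),\dots,(n\ n{+}1)\})$. For a Coxeter system $(W,S)$: $\ell(w)$ is the word length w.r.t. $S$; for $J\subseteq S$, $W_J=\langle J\rangle$, $W^J=\{w\in W\mid \ell(wj)>\ell(w)\ \forall j\in J\}$, and $G(W^J)$ is the graph on $W^J$ with $w\sim w'$ iff $w'=sw$ for some $s\in S$. $\iota_0(H)=\max\{|A|-|B|\mid V(H)=A\sqcup B,\ A,B\text{ independent}\}$. $(W,S)$ is cube-like with respect to $J\subseteq S$ if $W_J$ is abelian and $\iota_0(G(W^J))>0$. *)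

theory Defs
  imports
    Complex_Main
    "HOL-Algebra.Sym_Groups"
    "HOL-Algebra.Elementary_Groups"
    "HOL-Library.Ramsey"
begin

text \<open>
  A Coxeter system is represented by a group \<open>W\<close> and a generating set \<open>S\<close>. The notions
  below make sense for any such pair; the Coxeter relations are not needed to state them.
\<close>

definition word_length :: "('a, 'b) monoid_scheme \<Rightarrow> 'a set \<Rightarrow> 'a \<Rightarrow> nat" where
  "word_length W S w =
     (LEAST k. \<exists>ws. set ws \<subseteq> S \<and> length ws = k \<and> foldr (mult W) ws \<one>\<^bsub>W\<^esub> = w)"

definition parabolic :: "('a, 'b) monoid_scheme \<Rightarrow> 'a set \<Rightarrow> ('a, 'b) monoid_scheme" where
  "parabolic W J = subgroup_generated W J"

definition min_coset_reps :: "('a, 'b) monoid_scheme \<Rightarrow> 'a set \<Rightarrow> 'a set \<Rightarrow> 'a set" where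
  "min_coset_reps W S J =
     {w \<in> carrier W. \<forall>j\<in>J. word_length W S (w \<otimes>\<^bsub>W\<^esub> j) > word_length W S w}"

text \<open>
  Graphs are pairs of a vertex set and a set of two-element edges. As no element of \<open>S\<close> is the
  identity, the edge set below contains no singletons.
\<close>

definition coset_graph ::
    "('a, 'b) monoid_scheme \<Rightarrow> 'a set \<Rightarrow> 'a set \<Rightarrow> 'a set \<times> 'a set set" where
  "coset_graph W S J =
     (min_coset_reps W S J,
      {{w, w'} | w w'. w \<in> min_coset_reps W S J \<and> w' \<in> min_coset_reps W S J \<and>
                       (\<exists>s\<in>S. w' = s \<otimes>\<^bsub>W\<^esub> w)})"

text \<open>
  The maximum is taken over ordered bipartitions, so it is meaningful for finite bipartite
  graphs only. Independence is \<^const>\<open>indep\<close>.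
\<close>

definition iota0 :: "'a set \<times> 'a set set \<Rightarrow> int" where
  "iota0 H =
     Max {int (card A) - int (card B) | A B.
            A \<union> B = fst H \<and> A \<inter> B = {} \<and> indep A (snd H) \<and> indep B (snd H)}"

definition cube_like :: "('a, 'b) monoid_scheme \<Rightarrow> 'a set \<Rightarrow> 'a set \<Rightarrow> bool" where
  "cube_like W S J \<longleftrightarrow>
     J \<subseteq> S \<and> comm_group (parabolic W J) \<and> iota0 (coset_graph W S J) > 0"

text \<open>The Coxeter system of type $A_n$ is \<open>sym_group (n + 1)\<close> with these generators.\<close>

definition simple_transpositions :: "nat \<Rightarrow> (nat \<Rightarrow> nat) set" where
  "simple_transpositions n = {transpose i (i + 1) | i. 1 \<le> i \<and> i \<le> n}"

end

theory Submission
  imports Defs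
begin

text \<open>
  Take \<open>J\<close> to be the simple transpositions \<open>(1 2), (3 4), \<dots>\<close>. They commute, and \<open>W\<^sup>J\<close> consists of
  the permutations increasing on each block \<open>{2i+1, 2i+2}\<close>. Left multiplication by a simple
  transposition changes the sign, so the even and the odd elements of \<open>W\<^sup>J\<close> form a bipartition of the
  graph into independent sets, with difference the sum of the signs over \<open>W\<^sup>J\<close>. Exchanging the
  values of the first block that is not the image of a block is a sign-reversing involution; the
  remaining permutations permute the \<open>\<lceil>n/2\<rceil>\<close> blocks rigidly, and are all even.
\<close>

section \<open>Word length in the symmetric group\<close>

abbreviation adj :: "nat \<Rightarrow> nat \<Rightarrow> nat" where
  "adj i \<equiv> transpose i (Suc i)"

text \<open>Inversions are recorded by positions rather than by values, so that right multiplication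
  by \<open>adj j\<close> acts on the recorded pairs.\<close>

definition inversions :: "nat \<Rightarrow> (nat \<Rightarrow> nat) \<Rightarrow> (nat \<times> nat) set" where
  "inversions m w = {(a, b). 1 \<le> a \<and> a < b \<and> b \<le> m \<and> w b < w a}"

lemma finite_inversions: "finite (inversions m w)"
  by (rule finite_subset[of _ "{1..m} \<times> {1..m}"]) (auto simp: inversions_def)

lemma inversions_id: "inversions m id = {}"
  by (auto simp: inversions_def)

text \<open>No natural number lies strictly between \<open>j\<close> and \<open>Suc j\<close>, so
  exchanging them affects no other comparison. This serves for positions when inversions are counted
  and for values when a block is flipped.\<close>

lemma adj_less:
  assumes "a < b" "(a, b) \<noteq> (j, Suc j)"
  shows "adj j a < adj j b"
  using assms by (auto simp: transpose_def)

lemma adj_permutes: "1 \<le> j \<Longrightarrow> j < m \<Longrightarrow> adj j permutes {1..m}"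
  by (rule permutes_swap_id) auto

text \<open>Applying \<open>adj j\<close> to both entries of a pair matches the inversions of
  \<open>w\<close> with those of \<open>w \<circ> adj j\<close> other than
  \<open>(j, Suc j)\<close>, and this last pair is the one new inversion.\<close>

lemma card_inversions_ascent:
  assumes j: "1 \<le> j" "j < m" and asc: "w j < w (Suc j)"
  shows "card (inversions m (w \<circ> adj j)) = Suc (card (inversions m w))"
proof -
  let ?s = "adj j"
  let ?f = "map_prod ?s ?s"
  have range: "?s a \<in> {1..m} \<longleftrightarrow> a \<in> {1..m}" for a
    using permutes_in_image[OF adj_permutes[OF j]] .
  have sub: "?f x \<in> inversions m (w \<circ> ?s) - {(j, Suc j)}" if "x \<in> inversions m w" for x
  proof -
    obtain a b where x: "x = (a, b)" by force
    have ab: "a < b" "w b < w a" "a \<in> {1..m}" "b \<in> {1..m}"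
      using that by (auto simp: inversions_def x)
    have ne: "(a, b) \<noteq> (j, Suc j)" using ab asc by auto
    have "?s a < ?s b" by (rule adj_less[OF ab(1) ne])
    moreover have "(?s a, ?s b) \<noteq> (j, Suc j)"
      using ab(1) by (auto simp: transpose_def split: if_splits)
    ultimately show ?thesis
      using ab range[of a] range[of b] by (auto simp: inversions_def x)
  qed
  have sup: "?f x \<in> inversions m w" if "x \<in> inversions m (w \<circ> ?s) - {(j, Suc j)}" for x
  proof -
    obtain a b where x: "x = (a, b)" by force
    have ab: "a < b" "w (?s b) < w (?s a)" "a \<in> {1..m}" "b \<in> {1..m}" "(a, b) \<noteq> (j, Suc j)"
      using that by (auto simp: inversions_def x)
    show ?thesis
      using ab adj_less[OF ab(1,5)] range[of a] range[of b] by (auto simp: inversions_def x)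
  qed
  have "bij_betw ?f (inversions m w) (inversions m (w \<circ> ?s) - {(j, Suc j)})"
  proof (rule bij_betw_byWitness[where f' = ?f])
    show "?f ` inversions m w \<subseteq> inversions m (w \<circ> ?s) - {(j, Suc j)}"
      by (rule image_subsetI, rule sub)
    show "?f ` (inversions m (w \<circ> ?s) - {(j, Suc j)}) \<subseteq> inversions m w"
      by (rule image_subsetI, rule sup)
  qed auto
  hence "card (inversions m w) = card (inversions m (w \<circ> ?s) - {(j, Suc j)})"
    by (rule bij_betw_same_card)
  moreover have "(j, Suc j) \<in> inversions m (w \<circ> ?s)"
    using j asc by (auto simp: inversions_def)
  ultimately show ?thesis
    using card_Suc_Diff1[OF finite_inversions] by metis
qed

lemma card_inversions_descent:
  assumes j: "1 \<le> j" "j < m" and desc: "w (Suc j) < w j"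
  shows "card (inversions m w) = Suc (card (inversions m (w \<circ> adj j)))"
  using card_inversions_ascent[OF j, of "w \<circ> adj j"] desc by (simp add: comp_assoc)

section \<open>Word length as the number of inversions\<close>

lemma foldr_comp: "foldr (\<circ>) ws x = foldr (\<circ>) ws id \<circ> x"
  by (induction ws) (simp_all add: comp_assoc)

lemma simple_transpositions_permutes:
  "s \<in> simple_transpositions n \<Longrightarrow> s permutes {1..Suc n}"
  unfolding simple_transpositions_def using adj_permutes by fastforce

lemma foldr_simple_transpositions_permutes:
  "set ws \<subseteq> simple_transpositions n \<Longrightarrow> foldr (\<circ>) ws id permutes {1..Suc n}"
proof (induction ws)
  case Nil
  show ?case by (metis foldr.simps(1) id_apply permutes_id)
next
  case (Cons s ws)
  hence "foldr (\<circ>) ws id permutes {1..Suc n}" "s \<in> simple_transpositions n"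
    by (metis insert_subset list.simps(15))+
  hence "s \<circ> foldr (\<circ>) ws id permutes {1..Suc n}"
    by (rule permutes_compose[OF _ simple_transpositions_permutes])
  thus ?case by (metis comp_apply foldr.simps(2))
qed

text \<open>Lower bound for the length: each letter appended on the right changes the number of
  inversions by exactly one, up or down.\<close>

lemma card_inversions_le_length:
  assumes "set ws \<subseteq> simple_transpositions n"
  shows "card (inversions (Suc n) (foldr (\<circ>) ws id)) \<le> length ws"
  using assms
proof (induction ws rule: rev_induct)
  case Nil
  show ?case by (simp add: inversions_id[unfolded id_def])
next
  case (snoc s ws)
  let ?w = "foldr (\<circ>) ws id"
  from snoc.prems obtain j where j: "1 \<le> j" "j < Suc n" "s = adj j"
    by (auto simp: simple_transpositions_def)
  have "inj ?w"
    using foldr_simple_transpositions_permutes[of ws n] snoc.prems permutes_inj by (metis le_sup_iff set_append)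
  hence "?w j \<noteq> ?w (Suc j)" by (metis injD n_not_Suc_n)
  hence "card (inversions (Suc n) (?w \<circ> s)) \<le> Suc (card (inversions (Suc n) ?w))"
    using card_inversions_ascent[OF j(1,2), of ?w] card_inversions_descent[OF j(1,2), of ?w] j(3)
    by (cases "?w j < ?w (Suc j)") auto
  moreover have "foldr (\<circ>) (ws @ [s]) id = ?w \<circ> s"
    using foldr_comp[of ws s] by simp
  moreover have "card (inversions (Suc n) ?w) \<le> length ws"
    using snoc by (metis le_sup_iff set_append)
  ultimately show ?case by (metis Suc_le_mono le_trans length_append_singleton)
qed

text \<open>Starting from \<open>1 \<le> w 1\<close>, the ascents give \<open>i \<le> w i\<close>
  throughout, which on an initial segment only the identity satisfies.\<close>

lemma permutes_no_descent_id:
  assumes w: "w permutes {1..Suc n}" and asc: "\<And>j. 1 \<le> j \<Longrightarrow> j \<le> n \<Longrightarrow> w j < w (Suc j)"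
  shows "w = id"
proof (rule permutes_natset_ge[OF w], rule ballI)
  fix i assume "i \<in> {1..Suc n}"
  hence "1 \<le> i" "i \<le> Suc n" by auto
  thus "i \<le> w i"
  proof (induction i rule: dec_induct)
    case base
    thus ?case using permutes_in_image[OF w, of 1] by auto
  next
    case (step i)
    thus ?case using asc[of i] by force
  qed
qed

text \<open>Bubble sort: as long as there is a descent at \<open>j\<close>, passing to
  \<open>w \<circ> adj j\<close> removes one inversion, and \<open>adj j\<close> becomes the last
  letter of the word.\<close>

lemma word_of_length_card_inversions:
  assumes "w permutes {1..Suc n}"
  shows "\<exists>ws. set ws \<subseteq> simple_transpositions n \<and> length ws = card (inversions (Suc n) w)
    \<and> foldr (\<circ>) ws id = w"
  using assms
proof (induction "card (inversions (Suc n) w)" arbitrary: w rule: less_induct)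
  case less
  show ?case
  proof (cases "\<forall>j. 1 \<le> j \<and> j \<le> n \<longrightarrow> w j < w (Suc j)")
    case True
    hence "w = id" using permutes_no_descent_id[OF less.prems] by blast
    thus ?thesis
      by (intro exI[of _ "[]"]) (simp add: inversions_id inversions_id[unfolded id_def])
  next
    case False
    then obtain j where j: "1 \<le> j" "j < Suc n" "\<not> w j < w (Suc j)" by auto
    have "w j \<noteq> w (Suc j)" using permutes_inj[OF less.prems] by (metis injD n_not_Suc_n)
    hence c: "card (inversions (Suc n) w) = Suc (card (inversions (Suc n) (w \<circ> adj j)))"
      using card_inversions_descent[OF j(1,2), of w] j(3) by auto
    have p: "w \<circ> adj j permutes {1..Suc n}"
      by (rule permutes_compose[OF adj_permutes[OF j(1,2)] less.prems])
    obtain ws where ws: "set ws \<subseteq> simple_transpositions n"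
        "length ws = card (inversions (Suc n) (w \<circ> adj j))" "foldr (\<circ>) ws id = w \<circ> adj j"
      using less.hyps[OF _ p] c by auto
    have "foldr (\<circ>) (ws @ [adj j]) id = w"
      using foldr_comp[of ws "adj j"] ws(3) by (simp add: comp_assoc)
    moreover have "adj j \<in> simple_transpositions n"
      using j by (auto simp: simple_transpositions_def)
    ultimately show ?thesis using ws c
      by (intro exI[of _ "ws @ [adj j]"]) auto
  qed
qed

lemma word_length_sym_group:
  assumes "w permutes {1..Suc n}"
  shows "word_length (sym_group (Suc n)) (simple_transpositions n) w = card (inversions (Suc n) w)"
  unfolding word_length_def sym_group_mult sym_group_one
proof (rule Least_equality)
  show "\<exists>ws. set ws \<subseteq> simple_transpositions n \<and> length ws = card (inversions (Suc n) w)
    \<and> foldr (\<circ>) ws id = w"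
    by (rule word_of_length_card_inversions[OF assms])
qed (use card_inversions_le_length in auto)

text \<open>Turns the length condition defining \<open>min_coset_reps\<close> into a comparison of
  two adjacent values.\<close>

lemma word_length_less_adj_iff:
  assumes w: "w permutes {1..Suc n}" and j: "1 \<le> j" "j < Suc n"
  shows "word_length (sym_group (Suc n)) (simple_transpositions n) w
      < word_length (sym_group (Suc n)) (simple_transpositions n) (w \<circ> adj j)
    \<longleftrightarrow> w j < w (Suc j)"
proof -
  have "w j \<noteq> w (Suc j)" using permutes_inj[OF w] by (metis injD n_not_Suc_n)
  thus ?thesis
    using card_inversions_ascent[OF j, of w] card_inversions_descent[OF j, of w]
    unfolding word_length_sym_group[OF w]
      word_length_sym_group[OF permutes_compose[OF adj_permutes[OF j] w]]
    by (cases "w j < w (Suc j)") auto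
qed

section \<open>Permutations increasing on blocks\<close>

text \<open>Points are counted from 1 but blocks from 0, so the first \<open>k\<close> blocks
  partition \<open>{1..2 * k}\<close>.\<close>

definition block :: "nat \<Rightarrow> nat set" where
  "block i = {Suc (2 * i), Suc (Suc (2 * i))}"

definition block_increasing :: "nat \<Rightarrow> nat \<Rightarrow> (nat \<Rightarrow> nat) set" where
  "block_increasing k m =
     {p. p permutes {1..m} \<and> (\<forall>i<k. p (Suc (2 * i)) < p (Suc (Suc (2 * i))))}"

text \<open>Here \<open>a\<close> indexes a block of values and \<open>i\<close> a block of
  positions; only the image as a set matters.\<close>

definition hits_block :: "nat \<Rightarrow> (nat \<Rightarrow> nat) \<Rightarrow> nat \<Rightarrow> bool" where
  "hits_block k p a \<longleftrightarrow> (\<exists>i<k. p ` block i = block a)"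

abbreviation swap_block :: "nat \<Rightarrow> nat \<Rightarrow> nat" where
  "swap_block a \<equiv> adj (Suc (2 * a))"

text \<open>Moves whole blocks as \<open>f\<close> moves their indices: \<open>y div 2\<close> is
  the index of the block and \<open>y mod 2\<close> the place inside it. The point 0 lies in no
  block and stays fixed.\<close>

definition block_perm :: "(nat \<Rightarrow> nat) \<Rightarrow> nat \<Rightarrow> nat" where
  "block_perm f x = (case x of 0 \<Rightarrow> 0 | Suc y \<Rightarrow> Suc (2 * f (y div 2) + y mod 2))"

lemma block_perm_simps:
  "block_perm f 0 = 0" "block_perm f (Suc (2 * i)) = Suc (2 * f i)"
  "block_perm f (Suc (Suc (2 * i))) = Suc (Suc (2 * f i))"
  by (simp_all add: block_perm_def)

lemma nat_block_cases:
  obtains "x = 0" | i where "x = Suc (2 * i)" | i where "x = Suc (Suc (2 * i))"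
proof (cases x)
  case (Suc y)
  thus ?thesis using that(2)[of "y div 2"] that(3)[of "y div 2"]
    by (cases "even y") (auto elim!: evenE oddE)
qed (use that in auto)

lemma finite_block_increasing: "finite (block_increasing k m)"
  by (rule finite_subset[OF _ finite_permutations[of "{1..m}"]]) (auto simp: block_increasing_def)

section \<open>The sign-reversing involution\<close>

lemma block_eq_iff: "block a = block b \<longleftrightarrow> a = b"
  by (auto simp: block_def doubleton_eq_iff)

lemma swap_block_image: "swap_block a ` block b = block b"
  by (cases "a = b") (auto simp: block_def transpose_def)

text \<open>Swapping inside one block of values maps every block onto itself. Hence a flip leaves
  the set of missed blocks unchanged.\<close>

lemma hits_block_swap_block: "hits_block k (swap_block a \<circ> p) b \<longleftrightarrow> hits_block k p b"
proof -
  have "(swap_block a \<circ> p) ` block i = block b \<longleftrightarrow> p ` block i = block b" for i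
    using swap_block_image[of a b] inj_image_eq_iff[of "swap_block a" "p ` block i" "block b"]
    by (metis image_comp inj_transpose)
  thus ?thesis by (simp add: hits_block_def)
qed

text \<open>The swap reverses only the pair of values forming block \<open>a\<close>, and no
  position block takes exactly these two values.\<close>

lemma swap_block_in_block_increasing:
  assumes p: "p \<in> block_increasing k m" and a: "a < k" "\<not> hits_block k p a" and "2 * k \<le> m"
  shows "swap_block a \<circ> p \<in> block_increasing k m"
proof -
  have "(swap_block a \<circ> p) (Suc (2 * i)) < (swap_block a \<circ> p) (Suc (Suc (2 * i)))" if "i < k" for i
  proof -
    have "p ` block i \<noteq> block a" using a that by (auto simp: hits_block_def)
    thus ?thesis
      using p that by (auto simp: block_increasing_def block_def intro!: adj_less)
  qed
  moreover have "swap_block a \<circ> p permutes {1..m}"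
    using p a assms(4)
    by (intro permutes_compose[OF _ adj_permutes]) (auto simp: block_increasing_def)
  ultimately show ?thesis by (simp add: block_increasing_def)
qed

lemma sign_adj_comp:
  assumes "permutation p"
  shows "sign (adj j \<circ> p) = - sign p"
  using sign_compose[OF permutation_swap_id assms, of j "Suc j"] by (simp add: sign_swap_id)

text \<open>Flipping the values of the first missed block is an involution of the index set that
  negates every sign, so the integer sum equals its own negative.\<close>

lemma sum_sign_missed_block:
  assumes "2 * k \<le> m"
  shows "(\<Sum>p | p \<in> block_increasing k m \<and> (\<exists>a<k. \<not> hits_block k p a). sign p) = 0"
    (is "sum sign ?M = 0")
proof -
  define first where "first p = (LEAST a. a < k \<and> \<not> hits_block k p a)" for p
  define flip where "flip p = swap_block (first p) \<circ> p" for p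
  have first: "first p < k" "\<not> hits_block k p (first p)" if "p \<in> ?M" for p
    using that LeastI_ex[of "\<lambda>a. a < k \<and> \<not> hits_block k p a"] unfolding first_def by auto
  \<comment> \<open>\<open>p\<close> and \<open>flip p\<close> miss the same blocks, so the two
    \<open>LEAST\<close> terms agree for every \<open>p\<close>, even where no block is
    missed.\<close>
  have "first (flip p) = first p" for p
    unfolding first_def[of "flip p"] by (simp add: flip_def hits_block_swap_block first_def)
  hence flip_flip: "flip (flip p) = p" for p
    unfolding flip_def[of "flip p"] by (simp add: flip_def comp_assoc[symmetric])
  have flip_M: "flip p \<in> ?M" if "p \<in> ?M" for p
  proof -
    have "flip p \<in> block_increasing k m"
      unfolding flip_def
      by (rule swap_block_in_block_increasing) (use that first[OF that] assms in auto)
    thus ?thesis using that by (auto simp: flip_def hits_block_swap_block)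
  qed
  have "sum sign ?M = (\<Sum>p\<in>?M. sign (flip p))"
    by (rule sum.reindex_bij_witness[of _ flip flip]) (use flip_flip flip_M in auto)
  also have "\<dots> = (\<Sum>p\<in>?M. - sign p)"
  proof (rule sum.cong[OF refl])
    fix p assume "p \<in> ?M"
    hence "permutation p" by (auto simp: block_increasing_def permutation_permutes)
    thus "sign (flip p) = - sign p" unfolding flip_def by (rule sign_adj_comp)
  qed
  finally show ?thesis by (simp add: sum_negf)
qed

section \<open>Signs of rigid block permutations\<close>

lemma block_perm_comp: "block_perm (f \<circ> g) = block_perm f \<circ> block_perm g"
proof
  show "block_perm (f \<circ> g) x = (block_perm f \<circ> block_perm g) x" for x
    by (cases x rule: nat_block_cases) (simp_all add: block_perm_simps)
qed

lemma block_perm_id: "block_perm id = id"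
proof
  show "block_perm id x = id x" for x
    by (cases x rule: nat_block_cases) (simp_all add: block_perm_simps)
qed

text \<open>Two blocks are exchanged by one transposition of their first points and one of their
  second points; this pairing is the source of evenness.\<close>

lemma block_perm_transpose:
  "block_perm (transpose a b) =
     transpose (Suc (2 * a)) (Suc (2 * b)) \<circ> transpose (Suc (Suc (2 * a))) (Suc (Suc (2 * b)))"
proof
  show "block_perm (transpose a b) x = (transpose (Suc (2 * a)) (Suc (2 * b)) \<circ>
    transpose (Suc (Suc (2 * a))) (Suc (Suc (2 * b)))) x" for x
    by (cases x rule: nat_block_cases) 
      (auto simp: block_perm_simps transpose_def Suc_double_not_eq_double double_not_eq_Suc_double)
qed

text \<open>Induction over a product of transpositions: each factor of \<open>f\<close> contributes
  two transpositions of points, whose signs cancel.\<close>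

lemma block_perm_even_permutation:
  assumes "f permutes {..<k}" "2 * k \<le> m"
  shows "block_perm f permutes {1..m} \<and> sign (block_perm f) = 1"
  using assms(1) finite_lessThan
proof (induction f rule: permutes_induct)
  case id
  show ?case by (simp only: block_perm_id sign_id permutes_id simp_thms)
next
  case (swap a b f)
  let ?t = "transpose (Suc (2 * a)) (Suc (2 * b))"
  let ?u = "transpose (Suc (Suc (2 * a))) (Suc (Suc (2 * b)))"
  have perm: "?t permutes {1..m}" "?u permutes {1..m}"
    using swap assms(2) by (auto intro!: permutes_swap_id)
  have f: "permutation (block_perm f)"
    using swap by (auto simp: permutation_permutes)
  have "sign (?t \<circ> (?u \<circ> block_perm f)) = 1"
    using swap f by (simp add: sign_compose permutation_compose permutation_swap_id sign_swap_id)
  moreover have "?t \<circ> (?u \<circ> block_perm f) permutes {1..m}"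
    using swap perm by (intro permutes_compose) auto
  ultimately show ?case
    by (simp only: block_perm_comp block_perm_transpose comp_assoc simp_thms)
qed

lemma inj_block_perm: "inj block_perm"
proof (rule injI, rule ext)
  fix f g i assume "block_perm f = block_perm g"
  hence "block_perm f (Suc (2 * i)) = block_perm g (Suc (2 * i))" by simp
  thus "f i = g i" by (simp add: block_perm_simps)
qed

section \<open>Permutations that hit every block\<close>

lemma block_perm_image_block: "block_perm f ` block i = block (f i)"
  by (simp add: block_def block_perm_simps)

text \<open>Pigeonhole: choosing for each value block a position block mapped onto it gives an
  injection of \<open>{..<k}\<close> into itself, hence a surjection, so every position block is
  chosen.\<close>

lemma hits_all_blocks_image:
  assumes hits: "\<forall>a<k. hits_block k p a" and "i < k"
  obtains a where "a < k" "p ` block i = block a"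
proof -
  obtain g where g: "g a < k" "p ` block (g a) = block a" if "a < k" for a
    using hits unfolding hits_block_def by metis
  have "inj_on g {..<k}"
    using g by (intro inj_onI) (metis block_eq_iff lessThan_iff)
  hence "g ` {..<k} = {..<k}"
    using g by (intro endo_inj_surj) auto
  then obtain a where "a < k" "g a = i" using \<open>i < k\<close> by (metis imageE lessThan_iff)
  thus ?thesis using g that by blast
qed

lemma hits_all_blocks_block_perm:
  assumes p: "p \<in> block_increasing k m" and hits: "\<forall>a<k. hits_block k p a"
    and m: "m \<le> Suc (2 * k)"
  obtains f where "f permutes {..<k}" "p = block_perm f"
proof -
  have perm: "p permutes {1..m}" and inc: "\<And>i. i < k \<Longrightarrow> p (Suc (2 * i)) < p (Suc (Suc (2 * i)))"
    using p by (auto simp: block_increasing_def)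
  have inj: "p x = p y \<Longrightarrow> x = y" for x y using permutes_inj[OF perm] by (rule injD)
  \<comment> \<open>The value at the first point of block \<open>i\<close> will be
    \<open>Suc (2 * a)\<close>, and halving recovers \<open>a\<close>. The default \<open>i\<close>
    makes \<open>f\<close> fix all indices outside \<open>{..<k}\<close>.\<close>
  define f where "f i = (if i < k then p (Suc (2 * i)) div 2 else i)" for i
  have f: "f i < k \<and> p (Suc (2 * i)) = Suc (2 * f i) \<and> p (Suc (Suc (2 * i))) = Suc (Suc (2 * f i))"
    if i: "i < k" for i
  proof -
    obtain a where a: "a < k" "p ` block i = block a"
      using hits_all_blocks_image[OF hits i] .
    \<comment> \<open>Monotonicity on the block rules out the reversed matching of the two
      points.\<close>
    hence "p (Suc (2 * i)) = Suc (2 * a) \<and> p (Suc (Suc (2 * i))) = Suc (Suc (2 * a))"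
      using inc[OF i] by (auto simp: block_def doubleton_eq_iff)
    thus ?thesis using a i by (simp add: f_def)
  qed
  have "inj_on f {..<k}"
  proof (rule inj_onI)
    fix i j assume "i \<in> {..<k}" "j \<in> {..<k}" "f i = f j"
    hence "p (Suc (2 * i)) = p (Suc (2 * j))" using f by simp
    thus "i = j" using inj by fastforce
  qed
  moreover from this have "f ` {..<k} = {..<k}"
    using f by (intro endo_inj_surj) auto
  ultimately have "f permutes {..<k}"
    by (intro bij_imp_permutes) (auto simp: bij_betw_def f_def)
  moreover have "p x = block_perm f x" for x
  proof -
    consider "x = 0" | i where "i < k" "x \<in> block i" | "x > 2 * k"
    proof (cases x rule: nat_block_cases)
      case (2 i)
      thus ?thesis using that(2)[of i] that(3) by (cases "i < k") (auto simp: block_def)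
    next
      case (3 i)
      thus ?thesis using that(2)[of i] that(3) by (cases "i < k") (auto simp: block_def)
    qed (use that in auto)
    thus ?thesis
    proof cases
      case 1
      thus ?thesis using permutes_not_in[OF perm, of 0] by (simp add: block_perm_simps)
    next
      case 2
      thus ?thesis using f[of i] by (auto simp: block_def block_perm_simps)
    next
      case 3
      have "p x = x"
      proof (cases "x \<le> m")
        case True
        \<comment> \<open>At most one point of \<open>{1..m}\<close> lies outside the blocks. All
          values up to \<open>2 * k\<close> are already taken on the blocks, so this point must be
          fixed.\<close>
        hence x: "x = Suc (2 * k)" "m = Suc (2 * k)" using 3 m by auto
        have "p x \<in> {1..m}" using permutes_in_image[OF perm, of x] x by auto
        moreover have "\<not> p x \<le> 2 * k"
        proof
          assume "p x \<le> 2 * k"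
          with \<open>p x \<in> {1..m}\<close> have "\<exists>a<k. p x \<in> block a"
            by (cases "p x" rule: nat_block_cases)
              (auto simp: block_def Suc_double_not_eq_double double_not_eq_Suc_double)
          then obtain a where a: "a < k" "p x \<in> block a" by blast
          then obtain i where "i < k" "p ` block i = block a"
            using hits by (auto simp: hits_block_def)
          then obtain z where "z \<in> block i" "p z = p x" using a by (metis imageE)
          hence "x \<in> block i" using inj by metis
          thus False using \<open>i < k\<close> x by (auto simp: block_def)
        qed
        ultimately show ?thesis using x by auto
      qed (use permutes_not_in[OF perm] in auto)
      moreover have "block_perm f x = x"
        by (cases x rule: nat_block_cases) (use 3 in \<open>auto simp: block_perm_simps f_def\<close>)
      ultimately show ?thesis by simp
    qed
  qed
  hence "p = block_perm f" ..
  ultimately show ?thesis using that by blast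
qed

lemma hits_all_blocks_eq:
  assumes "2 * k \<le> m" "m \<le> Suc (2 * k)"
  shows "{p \<in> block_increasing k m. \<forall>a<k. hits_block k p a} = block_perm ` {f. f permutes {..<k}}"
    (is "?L = ?R")
proof
  show "?L \<subseteq> ?R" using hits_all_blocks_block_perm[OF _ _ assms(2)] by blast
  show "?R \<subseteq> ?L"
  proof
    fix p assume "p \<in> ?R"
    then obtain f where f: "f permutes {..<k}" and p: "p = block_perm f" by auto
    have "hits_block k p a" if "a < k" for a
    proof -
      obtain i where "i < k" "f i = a"
        using permutes_image[OF f] \<open>a < k\<close> by (metis imageE lessThan_iff)
      thus ?thesis by (auto simp: hits_block_def p block_perm_image_block)
    qed
    thus "p \<in> ?L"
      using block_perm_even_permutation[OF f assms(1)]
      by (auto simp: block_increasing_def p block_perm_simps)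
  qed
qed

text \<open>The hypotheses say that \<open>m\<close> is \<open>2 * k\<close> or
  \<open>2 * k + 1\<close>. After the cancellation, each permutation of the \<open>k\<close> blocks
  contributes 1.\<close>

lemma sum_sign_block_increasing:
  assumes "2 * k \<le> m" "m \<le> Suc (2 * k)"
  shows "(\<Sum>p\<in>block_increasing k m. sign p) = fact k"
proof -
  let ?H = "{p \<in> block_increasing k m. \<forall>a<k. hits_block k p a}"
  let ?M = "{p. p \<in> block_increasing k m \<and> (\<exists>a<k. \<not> hits_block k p a)}"
  have "(\<Sum>p\<in>block_increasing k m. sign p) = sum sign ?H + sum sign ?M"
    using finite_block_increasing
    by (subst sum.union_disjoint[symmetric]) (auto intro!: sum.cong)
  also have "sum sign ?M = 0" by (rule sum_sign_missed_block[OF assms(1)])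
  also have "sum sign ?H = (\<Sum>f | f permutes {..<k}. sign (block_perm f))"
    unfolding hits_all_blocks_eq[OF assms]
    by (subst sum.reindex[OF inj_on_subset[OF inj_block_perm]]) auto
  also have "\<dots> = (\<Sum>f | f permutes {..<k}. 1)"
    using block_perm_even_permutation[OF _ assms(1)] by (intro sum.cong) auto
  also have "\<dots> = fact k"
    using card_permutations[OF card_lessThan finite_lessThan, of k] by simp
  finally show ?thesis by simp
qed

section \<open>The coset graph\<close>

text \<open>An element commuting with all generators commutes with everything they generate. This is
  used twice: first for a fixed generator, then for an arbitrary generated element.\<close>

lemma (in group) comm_group_subgroup_generated:
  assumes comm: "\<And>x y. x \<in> S \<Longrightarrow> y \<in> S \<Longrightarrow> x \<otimes> y = y \<otimes> x"
  shows "comm_group (subgroup_generated G S)"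
proof -
  let ?S = "carrier G \<inter> S"
  have closed: "x \<in> carrier G" if "x \<in> generate G ?S" for x
    using generate_in_carrier[OF _ that] by blast
  \<comment> \<open>Handles the inverted generators in the induction over
    \<open>generate\<close>.\<close>
  have inv_comm: "inv x \<otimes> y = y \<otimes> inv x"
    if "x \<in> carrier G" "y \<in> carrier G" "x \<otimes> y = y \<otimes> x" for x y
  proof -
    have "inv x \<otimes> y = inv x \<otimes> (y \<otimes> x) \<otimes> inv x" using that(1,2) by (simp add: m_assoc)
    also have "\<dots> = inv x \<otimes> (x \<otimes> y) \<otimes> inv x" using that(3) by simp
    also have "\<dots> = y \<otimes> inv x" using that(1,2) by (simp flip: m_assoc)
    finally show ?thesis .
  qed
  have generated_comm: "x \<otimes> y = y \<otimes> x"
    if "x \<in> generate G ?S" and y: "y \<in> carrier G" and "\<And>s. s \<in> ?S \<Longrightarrow> s \<otimes> y = y \<otimes> s" for x y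
    using that(1)
  proof (induction rule: generate.induct)
    case (eng g h)
    have "g \<otimes> h \<otimes> y = g \<otimes> (y \<otimes> h)" using eng closed y by (simp add: m_assoc)
    also have "\<dots> = y \<otimes> (g \<otimes> h)" using eng closed y by (simp flip: m_assoc)
    finally show ?case .
  qed (use y that(3) inv_comm in auto)
  show ?thesis
  proof (rule group.group_comm_groupI[OF group_subgroup_generated])
    fix x y
    assume "x \<in> carrier (subgroup_generated G S)" "y \<in> carrier (subgroup_generated G S)"
    hence x: "x \<in> generate G ?S" and y: "y \<in> generate G ?S"
      by (simp_all add: carrier_subgroup_generated)
    have "s \<otimes> y = y \<otimes> s" if "s \<in> ?S" for s
      using generated_comm[OF y, of s] comm that by auto
    thus "x \<otimes>\<^bsub>subgroup_generated G S\<^esub> y = y \<otimes>\<^bsub>subgroup_generated G S\<^esub> x"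
      using generated_comm[OF x closed[OF y]] by simp
  qed
qed

text \<open>Each \<open>swap_block i\<close> imposes one comparison, at the two positions of block
  \<open>i\<close>. The value \<open>Suc n div 2\<close> is the number of full blocks in
  \<open>{1..Suc n}\<close>.\<close>

lemma min_coset_reps_swap_blocks:
  fixes n :: nat
  defines "k \<equiv> Suc n div 2"
  shows "min_coset_reps (sym_group (Suc n)) (simple_transpositions n) (swap_block ` {..<k})
    = block_increasing k (Suc n)"
proof -
  have "(\<forall>j\<in>swap_block ` {..<k}.
        word_length (sym_group (Suc n)) (simple_transpositions n) w
          < word_length (sym_group (Suc n)) (simple_transpositions n) (w \<circ> j))
      \<longleftrightarrow> (\<forall>i<k. w (Suc (2 * i)) < w (Suc (Suc (2 * i))))"
    if w: "w permutes {1..Suc n}" for w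
    using word_length_less_adj_iff[OF w, of "Suc (2 * _)"] by (auto simp: k_def)
  thus ?thesis
    unfolding min_coset_reps_def block_increasing_def sym_group_carrier sym_group_mult by blast
qed

text \<open>Any bipartition bounds \<open>Max\<close> from below once the set of differences is
  finite, which follows because both parts are subsets of a finite vertex set.\<close>

lemma iota0_ge:
  assumes "finite (fst H)" "A \<union> B = fst H" "A \<inter> B = {}" "indep A (snd H)" "indep B (snd H)"
  shows "int (card A) - int (card B) \<le> iota0 H"
  unfolding iota0_def
proof (rule Max_ge)
  let ?d = "\<lambda>A B. int (card A) - int (card B)"
  let ?D = "{?d A B | A B. A \<union> B = fst H \<and> A \<inter> B = {} \<and> indep A (snd H) \<and> indep B (snd H)}"
  have "finite {?d A B | A B. A \<in> Pow (fst H) \<and> B \<in> Pow (fst H)}"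
    using assms(1) by (intro finite_image_set2) (simp_all only: Collect_mem_eq finite_Pow_iff)
  thus "finite ?D"
    by (rule rev_finite_subset) (intro Collect_mono ex_mono, intro impI conjI; (elim conjE)?; blast)
  show "?d A B \<in> ?D"
    unfolding mem_Collect_eq by (intro exI[of _ A] exI[of _ B] conjI refl assms)
qed

text \<open>The endpoints of an edge differ by left multiplication by a transposition, so their
  signs are opposite and cannot both equal \<open>c\<close>.\<close>

lemma indep_equal_sign:
  assumes "V \<subseteq> {p. p permutes {1..Suc n}}" and "\<And>p. p \<in> V \<Longrightarrow> sign p = c"
  shows "indep V (snd (coset_graph (sym_group (Suc n)) (simple_transpositions n) J))"
proof -
  have opp: "sign (s \<circ> p) = - sign p"
    if "p \<in> V" "s \<in> simple_transpositions n" for p s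
  proof -
    have "permutation p" using assms(1) that by (auto simp: permutation_permutes)
    thus ?thesis using that by (auto simp: simple_transpositions_def sign_adj_comp)
  qed
  have "v \<noteq> s \<circ> w" if "v \<in> V" "w \<in> V" "s \<in> simple_transpositions n" for v w s
    using opp[OF that(2,3)] assms(2)[OF that(1)] assms(2)[OF that(2)] sign_nz[of w] by auto
  thus ?thesis
    by (auto simp: indep_def coset_graph_def sym_group_mult doubleton_eq_iff)
qed

lemma sum_sign_eq_card_diff:
  assumes "finite V"
  shows "(\<Sum>p\<in>V. sign p) = int (card {p \<in> V. sign p = 1}) - int (card {p \<in> V. sign p = - 1})"
  using assms
proof (induction V)
  case (insert p V)
  have "{q \<in> insert p V. sign q = c} =
      (if sign p = c then insert p {q \<in> V. sign q = c} else {q \<in> V. sign q = c})" for c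
    by auto
  thus ?case using insert by (cases p rule: sign_cases) simp_all
qed simp

text \<open>The bipartition fed into \<open>iota0_ge\<close> consists of the even and the odd
  vertices.\<close>

lemma iota0_coset_graph_ge_sum_sign:
  fixes n :: nat and J :: "(nat \<Rightarrow> nat) set"
  defines "V \<equiv> min_coset_reps (sym_group (Suc n)) (simple_transpositions n) J"
  shows "(\<Sum>p\<in>V. sign p)
    \<le> iota0 (coset_graph (sym_group (Suc n)) (simple_transpositions n) J)"
proof -
  have V: "V \<subseteq> {p. p permutes {1..Suc n}}"
    by (auto simp: V_def min_coset_reps_def sym_group_carrier simp del: One_nat_def)
  hence fin: "finite V" by (rule finite_subset) (simp add: finite_permutations)
  have "p \<in> V \<Longrightarrow> sign p = 1 \<or> sign p = - 1" for p
    by (cases p rule: sign_cases) auto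
  hence "{p \<in> V. sign p = 1} \<union> {p \<in> V. sign p = - 1} = V" by blast
  thus ?thesis
    unfolding sum_sign_eq_card_diff[OF fin]
    using V fin by (intro iota0_ge indep_equal_sign) (auto simp: coset_graph_def V_def)
qed

theorem theorem6p6:
  fixes n :: nat
  shows "\<exists>J. cube_like (sym_group (n + 1)) (simple_transpositions n) J \<and>
             iota0 (coset_graph (sym_group (n + 1)) (simple_transpositions n) J)
               \<ge> fact (nat \<lceil>real n / 2\<rceil>)"
proof -
  define k where "k = Suc n div 2"
  let ?W = "sym_group (Suc n)" and ?S = "simple_transpositions n" and ?J = "swap_block ` {..<k}"
  \<comment> \<open>Rounding \<open>n / 2\<close> up agrees with rounding \<open>(n + 1) / 2\<close>
    down, so the factorial asked for is that of the number of blocks.\<close>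
  have "\<lceil>real n / 2\<rceil> = int k"
    unfolding k_def by (rule ceiling_unique) linarith+
  hence k: "nat \<lceil>real n / 2\<rceil> = k" by simp
  have iota: "fact k \<le> iota0 (coset_graph ?W ?S ?J)"
    using iota0_coset_graph_ge_sum_sign[of n ?J] sum_sign_block_increasing[of k "Suc n"]
      min_coset_reps_swap_blocks[of n] by (simp add: k_def)
  moreover have "comm_group (parabolic ?W ?J)"
    unfolding parabolic_def
  proof (rule group.comm_group_subgroup_generated[OF sym_group_is_group])
    \<comment> \<open>Two block swaps are equal or move disjoint blocks; the pointwise check
      separates the points by parity.\<close>
    show "x \<otimes>\<^bsub>?W\<^esub> y = y \<otimes>\<^bsub>?W\<^esub> x" if "x \<in> ?J" "y \<in> ?J" for x y
      using that
      by (auto simp: sym_group_mult fun_eq_iff transpose_def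
          Suc_double_not_eq_double double_not_eq_Suc_double)
  qed
  moreover have "?J \<subseteq> ?S"
    by (force simp: simple_transpositions_def k_def)
  moreover have "0 < iota0 (coset_graph ?W ?S ?J)"
    using iota fact_gt_zero[of k, where ?'a = int] by linarith
  ultimately show ?thesis
    unfolding cube_like_def k by (intro exI[of _ ?J]) simp
qed

end
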